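(* Let $r\ge1$ and $X=\{1,2,\ldots,r\}$. For each total order $S$ on $X$, there are exactly $|X|!$ mahonian maj-inv statistics on $X^*$ which can be written $\mathrm{maj}'_U+\mathrm{inv}'_{S\setminus U}$ (with $U$ a relation on $X$).
   Context: $X=\{1,\ldots,r\}$ and $X^*$ is the set of finite words with letters in $X$. A relation on $X$ is a subset of $X\times X$; $x\,U\,y$ means $(x,y)\in U$. $\chi(P)=1$ if $P$ is true and $0$ otherwise. For a relation $U$ and a word $w=x_1\cdots x_n$, $\mathrm{inv}'_U(w)=\sum_{1\le i<j\le n}\chi(x_i\,U\,x_j)$ and $\mathrm{maj}'_U(w)=\sum_{i=1}^{n-1} i\,\chi(x_i\,U\,x_{i+1})$. A statistic on $X^*$ is a maj-inv statistic if it equals $\mathrm{maj}'_U+\mathrm{inv}'_V$ for some relations $U,V$ on $X$. For a sequence $\mathbf c=(c(1),\ldots,c(r))$ of non-negative integers, $\mathcal R(\mathbf c)$ is the set of all words obtained by permuting the letters of $1^{c(1)}2^{c(2)}\cdots r^{c(r)}$. A statistic $s$ on $X^*$ is mahonian if for every $\mathbf c$, $\sum_{w\in\mathcal R(\mathbf c)}q^{s(w)}=\sum_{w\in\mathcal R(\mathbf c)}q^{\mathrm{inv}(w)}$, where $\mathrm{inv}(w)=\sum_{i<j}\chi(x_i>x_j)$; equivalently, this sum is the $q$-multinomial coefficient $\frac{[c(1)+\cdots+c(r)]_q!}{[c(1)]_q!\cdots[c(r)]_q!}$. A total order is understood as strict: an irreflexive, transitive relation such that for distinct $x,y$ exactly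 one of $x\,S\,y$, $y\,S\,x$ holds. Statistics are counted as functions on $X^*$. *)

theory Defs
  imports "HOL-Computational_Algebra.Polynomial" "HOL-Library.Multiset" "HOL-Library.FuncSet"
begin

definition alphabet :: "nat \<Rightarrow> nat set" where
  "alphabet r = {1..r}"

definition words :: "nat \<Rightarrow> nat list set" where
  "words r = lists (alphabet r)"

(* Lists are indexed from 0, hence the weight Suc i where the word x_1 ... x_n has weight i. *)
definition maj' :: "(nat \<times> nat) set \<Rightarrow> nat list \<Rightarrow> nat" where
  "maj' U w = (\<Sum>i<length w - 1. Suc i * of_bool ((w ! i, w ! Suc i) \<in> U))"

definition inv' :: "(nat \<times> nat) set \<Rightarrow> nat list \<Rightarrow> nat" where
  "inv' U w = (\<Sum>j<length w. \<Sum>i<j. of_bool ((w ! i, w ! j) \<in> U))"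

definition inversions :: "nat list \<Rightarrow> nat" where
  "inversions w = (\<Sum>j<length w. \<Sum>i<j. of_bool (w ! i > w ! j))"

(* A statistic is an extensional function (undefined outside words r), so that equality of
   statistics is equality on words r, as needed for counting them. *)
definition maj_inv :: "nat \<Rightarrow> (nat \<times> nat) set \<Rightarrow> (nat \<times> nat) set \<Rightarrow> nat list \<Rightarrow> nat" where
  "maj_inv r U V = (\<lambda>w\<in>words r. maj' U w + inv' V w)"

definition maj_inv_statistic :: "nat \<Rightarrow> (nat list \<Rightarrow> nat) \<Rightarrow> bool" where
  "maj_inv_statistic r s \<longleftrightarrow>
     (\<exists>U V. U \<subseteq> alphabet r \<times> alphabet r \<and> V \<subseteq> alphabet r \<times> alphabet r \<and> s = maj_inv r U V)"

definition rearrangements :: "nat \<Rightarrow> (nat \<Rightarrow> nat) \<Rightarrow> nat list set" where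
  "rearrangements r c = {w. mset w = mset (concat (map (\<lambda>x. replicate (c x) x) [1..<Suc r]))}"

(* Equality of the generating functions as polynomials in q. *)
definition mahonian :: "nat \<Rightarrow> (nat list \<Rightarrow> nat) \<Rightarrow> bool" where
  "mahonian r s \<longleftrightarrow>
     (\<forall>c. (\<Sum>w\<in>rearrangements r c. monom (1::int) (s w)) =
          (\<Sum>w\<in>rearrangements r c. monom 1 (inversions w)))"

end

theory Submission
  imports Defs
begin

text \<open>
  The statistic \<open>maj' U + inv' (S - U)\<close> is mahonian iff \<open>U \<subseteq> S\<close> and every column
  \<open>{x. (x, y) \<in> U}\<close> is closed under \<open>S\<close>-predecessors. Necessity is read off words with at most
  three letters: if \<open>(x, y) \<in> U\<close>, \<open>(z, x) \<in> S\<close> and \<open>(z, y) \<notin> U\<close>, then the word \<open>zxy\<close> has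
  value 4, whereas no word of length 3 has more than 3 inversions. For sufficiency, the generating
  function over the rearrangements of a multiset is computed by removing the last letter; the
  resulting sums telescope along \<open>S\<close>. Finally, the admissible columns at \<open>y\<close> are the sets
  \<open>{z. (z, t) \<in> S}\<close> with \<open>t = y\<close> or \<open>(t, y) \<in> S\<close>, so there are \<open>1 \<cdot> 2 \<cdots> r\<close> choices, and \<open>U\<close> is
  recovered from the values of the statistic on the words \<open>yxy\<close>.
\<close>

section \<open>Finite strict linear orders and sums along them\<close>

lemma strict_linear_order_on_subset:
  assumes "strict_linear_order_on A S" "B \<subseteq> A"
  shows "strict_linear_order_on B S"
  using assms by (auto simp: strict_linear_order_on_def total_on_def)

lemma strict_linear_order_on_asym:
  assumes "strict_linear_order_on A S" "(x, y) \<in> S"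
  shows "(y, x) \<notin> S"
  using assms unfolding strict_linear_order_on_def irrefl_def trans_def by blast

lemma strict_linear_order_on_first:
  assumes "finite B" "B \<noteq> {}" "strict_linear_order_on B S"
  obtains m where "m \<in> B" "\<And>z. z \<in> B \<Longrightarrow> z \<noteq> m \<Longrightarrow> (m, z) \<in> S"
proof -
  have "\<exists>m\<in>B. \<forall>z\<in>B. z \<noteq> m \<longrightarrow> (m, z) \<in> S"
    using assms
  proof (induction rule: finite_ne_induct)
    case (singleton x)
    then show ?case by simp
  next
    case (insert x F)
    then obtain m where m: "m \<in> F" "\<forall>z\<in>F. z \<noteq> m \<longrightarrow> (m, z) \<in> S"
      by (meson strict_linear_order_on_subset subset_insertI)
    have "(x, m) \<in> S \<or> (m, x) \<in> S"
      using insert.prems insert.hyps m by (auto simp: strict_linear_order_on_def total_on_def)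
    then show ?case
    proof
      assume "(x, m) \<in> S"
      then have "\<forall>z\<in>F. (x, z) \<in> S"
        using m insert.prems unfolding strict_linear_order_on_def by (metis transD)
      then show ?thesis by auto
    next
      assume "(m, x) \<in> S"
      then show ?thesis using m by auto
    qed
  qed
  then show ?thesis using that by blast
qed

lemma strict_linear_order_on_converse:
  assumes "strict_linear_order_on A S"
  shows "strict_linear_order_on A (S\<inverse>)"
  using assms by (auto simp: strict_linear_order_on_def irrefl_def)

text \<open>Elements are adjoined in increasing order, so the initial segments of those already
  present stay unchanged. The top element is found as the first one for the converse order.\<close>

lemma finite_strict_linear_order_induct [consumes 2, case_names empty insert]:
  assumes "finite A" "strict_linear_order_on A S"
    and "P {}"
    and step: "\<And>m B. finite B \<Longrightarrow> m \<notin> B \<Longrightarrow> (\<And>z. z \<in> B \<Longrightarrow> (z, m) \<in> S) \<Longrightarrow> P B \<Longrightarrow> P (insert m B)"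
  shows "P A"
  using assms(1,2)
proof (induction "card A" arbitrary: A)
  case 0
  then show ?case using assms(3) by simp
next
  case (Suc n)
  obtain m where m: "m \<in> A" "\<And>z. z \<in> A \<Longrightarrow> z \<noteq> m \<Longrightarrow> (z, m) \<in> S"
    using strict_linear_order_on_first[OF Suc.prems(1) _ strict_linear_order_on_converse[OF Suc.prems(2)]]
      Suc.hyps(2) by (metis card.empty converse_iff nat.distinct(1))
  have "P (A - {m})"
    using Suc m(1) by (intro Suc.hyps(1)) (auto intro: strict_linear_order_on_subset)
  then have "P (insert m (A - {m}))"
    using Suc.prems(1) m by (intro step) auto
  then show ?case using m(1) by (simp add: insert_absorb)
qed

text \<open>Along \<open>S\<close> the initial segments have 1, 2, ..., \<open>card A\<close>
  elements.\<close>

lemma prod_card_initial_segments: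
  assumes "finite A" "strict_linear_order_on A S"
  shows "(\<Prod>y\<in>A. card {t \<in> A. t = y \<or> (t, y) \<in> S}) = fact (card A)"
  using assms
proof (induction rule: finite_strict_linear_order_induct)
  case empty
  then show ?case by simp
next
  case (insert m B)
  have "{t \<in> insert m B. t = y \<or> (t, y) \<in> S} = {t \<in> B. t = y \<or> (t, y) \<in> S}" if "y \<in> B" for y
    using insert.hyps that strict_linear_order_on_asym[OF assms(2)] by auto
  moreover have "{t \<in> insert m B. t = m \<or> (t, m) \<in> S} = insert m B"
    using insert.hyps by auto
  ultimately show ?case using insert by simp
qed

text \<open>The summand at \<open>b\<close> is a difference of two powers of \<open>q\<close>, with
  exponents the total weight before \<open>b\<close> and the total weight up to and including
  \<open>b\<close>.\<close>

lemma sum_telescope_strict_linear_order: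
  fixes q :: "'a :: comm_ring_1" and c :: "'b \<Rightarrow> nat"
  assumes "finite A" "strict_linear_order_on A S"
  shows "(\<Sum>b\<in>A. q ^ sum c {z \<in> A. (z, b) \<in> S} * (1 - q ^ c b)) = 1 - q ^ sum c A"
  using assms
proof (induction rule: finite_strict_linear_order_induct)
  case empty
  then show ?case by simp
next
  case (insert m B)
  have "{z \<in> insert m B. (z, b) \<in> S} = {z \<in> B. (z, b) \<in> S}" if "b \<in> B" for b
    using insert.hyps that strict_linear_order_on_asym[OF assms(2)] by auto
  moreover have "{z \<in> insert m B. (z, m) \<in> S} = B"
    using insert.hyps strict_linear_order_on_asym[OF assms(2)] by auto
  ultimately show ?case using insert by (simp add: algebra_simps power_add)
qed

text \<open>\<open>L\<close> meets \<open>A\<close> in an initial segment, and each of the two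
  blocks telescopes separately. The exponent depending on \<open>b \<in> L\<close> models the extra
  weight of a last letter \<open>b\<close> in \<open>L\<close>.\<close>

lemma sum_telescope_upset:
  fixes q :: "'a :: comm_ring_1" and c :: "'b \<Rightarrow> nat"
  assumes "finite A" "strict_linear_order_on A S"
    and up: "\<And>x z. x \<in> L \<Longrightarrow> z \<in> A - L \<Longrightarrow> (x, z) \<in> S"
  shows "(\<Sum>b\<in>A. q ^ (if b \<in> L then sum c A else 0) * q ^ sum c {z \<in> A. (z, b) \<in> S} * (1 - q ^ c b)) =
         q ^ sum c (A \<inter> L) * (1 - q ^ sum c A)"
proof -
  let ?n = "sum c A" and ?l = "sum c (A \<inter> L)" and ?m = "sum c (A - L)"
  let ?g = "\<lambda>b. q ^ (if b \<in> L then ?n else 0) * q ^ sum c {z \<in> A. (z, b) \<in> S} * (1 - q ^ c b)"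
  note asym = strict_linear_order_on_asym[OF assms(2)]
  have in_L: "{z \<in> A. (z, b) \<in> S} = {z \<in> A \<inter> L. (z, b) \<in> S}" if "b \<in> A \<inter> L" for b
    using that up asym by blast
  have "{z \<in> A. (z, b) \<in> S} = (A \<inter> L) \<union> {z \<in> A - L. (z, b) \<in> S}" if "b \<in> A - L" for b
    using that up by blast
  then have not_in_L: "sum c {z \<in> A. (z, b) \<in> S} = ?l + sum c {z \<in> A - L. (z, b) \<in> S}"
    if "b \<in> A - L" for b
    using that assms(1) by (subst sum.union_disjoint[symmetric]) auto
  have n: "?n = ?l + ?m"
    using assms(1) by (subst sum.union_disjoint[symmetric]) (auto intro: sum.cong)
  have "sum ?g A = sum ?g (A \<inter> L) + sum ?g (A - L)"
    by (rule sum.Int_Diff[OF assms(1)])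
  also have "sum ?g (A \<inter> L) =
      q ^ ?n * (\<Sum>b\<in>A \<inter> L. q ^ sum c {z \<in> A \<inter> L. (z, b) \<in> S} * (1 - q ^ c b))"
    unfolding sum_distrib_left by (intro sum.cong refl) (simp add: in_L mult.assoc)
  also have "(\<Sum>b\<in>A \<inter> L. q ^ sum c {z \<in> A \<inter> L. (z, b) \<in> S} * (1 - q ^ c b)) = 1 - q ^ ?l"
    using assms by (intro sum_telescope_strict_linear_order) (auto intro: strict_linear_order_on_subset)
  also have "sum ?g (A - L) =
      q ^ ?l * (\<Sum>b\<in>A - L. q ^ sum c {z \<in> A - L. (z, b) \<in> S} * (1 - q ^ c b))"
    unfolding sum_distrib_left by (intro sum.cong refl) (simp add: not_in_L power_add mult.assoc)
  also have "(\<Sum>b\<in>A - L. q ^ sum c {z \<in> A - L. (z, b) \<in> S} * (1 - q ^ c b)) = 1 - q ^ ?m"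
    using assms by (intro sum_telescope_strict_linear_order) (auto intro: strict_linear_order_on_subset)
  \<comment> \<open>With \<open>n = l + m\<close>, the blocks add up to
    \<open>q^n (1 - q^l) + q^l (1 - q^m) = q^l (1 - q^n)\<close>.\<close>
  finally show ?thesis by (simp add: n power_add algebra_simps)
qed

section \<open>q-factorials of multisets\<close>

text \<open>\<open>qprod q n\<close> is \<open>(1 - q)\<^sup>n [n]\<^sub>q!\<close>; with this normalisation the gap factors \<open>1 - q ^ k\<close> telescope
  and no division by \<open>1 - q\<close> occurs.\<close>

definition qprod :: "'a :: comm_ring_1 \<Rightarrow> nat \<Rightarrow> 'a" where
  "qprod q n = (\<Prod>i<n. 1 - q ^ Suc i)"

text \<open>The denominator of the q-multinomial coefficient, scaled by the same power of
  \<open>1 - q\<close> as the numerator \<open>qprod q (size N)\<close>.\<close>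

definition qprod_mset :: "'a :: comm_ring_1 \<Rightarrow> 'b multiset \<Rightarrow> 'a" where
  "qprod_mset q N = (\<Prod>x\<in>set_mset N. qprod q (count N x))"

lemma qprod_0 [simp]: "qprod q 0 = 1"
  by (simp add: qprod_def)

lemma qprod_pos: "n > 0 \<Longrightarrow> qprod q n = qprod q (n - 1) * (1 - q ^ n)"
  by (cases n) (simp_all add: qprod_def)

text \<open>Only the factor at \<open>b\<close> changes. The term split off is the gap factor
  required by the telescoping sums.\<close>

lemma qprod_mset_remove:
  assumes "b \<in># N"
  shows "qprod_mset q N = qprod_mset q (N - {#b#}) * (1 - q ^ count N b)"
proof -
  \<comment> \<open>If \<open>b\<close> occurs once it leaves the support, but its factor is then
    \<open>qprod q 0 = 1\<close>.\<close>
  have "qprod_mset q (N - {#b#}) = (\<Prod>x\<in>set_mset N. qprod q (count (N - {#b#}) x))"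
    unfolding qprod_mset_def
    by (rule prod.mono_neutral_left) (auto simp: not_in_iff dest: in_diffD)
  also have "\<dots> = qprod q (count N b - 1) * (\<Prod>x\<in>set_mset N - {b}. qprod q (count N x))"
  proof -
    have "(\<Prod>x\<in>set_mset N - {b}. qprod q (count (N - {#b#}) x)) =
        (\<Prod>x\<in>set_mset N - {b}. qprod q (count N x))"
      by (intro prod.cong refl) auto
    then show ?thesis
      using prod.remove[OF finite_set_mset assms, of "\<lambda>x. qprod q (count (N - {#b#}) x)"] by simp
  qed
  finally show ?thesis
    unfolding qprod_mset_def using assms
    by (subst prod.remove[OF _ assms]) (auto simp: qprod_pos mult_ac)
qed

lemma size_filter_mset_conv_sum:
  "size (filter_mset P N) = sum (count N) {z \<in> set_mset N. P z}"
  by (auto simp: size_multiset_overloaded_eq intro: sum.cong)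

section \<open>Generating functions by removal of the last letter\<close>

lemma maj'_Nil [simp]: "maj' U [] = 0"
  by (simp add: maj'_def)

lemma inv'_Nil [simp]: "inv' U [] = 0"
  by (simp add: inv'_def)

lemma maj'_snoc:
  "maj' U (w @ [x]) = maj' U w + (if w \<noteq> [] \<and> (last w, x) \<in> U then length w else 0)"
proof (cases "w = []")
  case True
  then show ?thesis by (simp add: maj'_def)
next
  case False
  then obtain m where m: "length w = Suc m" by (cases w) auto
  have "maj' U (w @ [x]) = (\<Sum>i<Suc m. Suc i * of_bool (((w @ [x]) ! i, (w @ [x]) ! Suc i) \<in> U))"
    using m by (simp add: maj'_def)
  also have "\<dots> = maj' U w + Suc m * of_bool ((w ! m, x) \<in> U)"
    using m by (simp add: maj'_def nth_append)
  finally show ?thesis using m False by (simp add: last_conv_nth)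
qed

text \<open>The increment depends on \<open>w\<close> only through \<open>mset w\<close>, so it is
  constant over all rearrangements of the prefix and factors out of the sum.\<close>

lemma inv'_snoc: "inv' V (w @ [x]) = inv' V w + size {#y \<in># mset w. (y, x) \<in> V#}"
proof -
  have "(\<Sum>i<length w. of_bool ((w ! i, x) \<in> V)) = size {#y \<in># mset w. (y, x) \<in> V#}"
    by (induction w rule: rev_induct) (auto simp: nth_append)
  then show ?thesis
    by (simp add: inv'_def nth_append)
qed

lemma finite_mset_eq: "finite {w. mset w = N}"
  using mset_eq_finite ex_mset by metis

lemma sum_mset_eq_snoc:
  assumes "N \<noteq> {#}"
  shows "(\<Sum>w | mset w = N. g w) = (\<Sum>b\<in>set_mset N. \<Sum>v | mset v = N - {#b#}. g (v @ [b]))"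
proof -
  have "{w. mset w = N} = (\<Union>b\<in>set_mset N. (\<lambda>v. v @ [b]) ` {v. mset v = N - {#b#}})"
    (is "_ = ?R")
  proof (intro equalityI subsetI)
    fix w assume "w \<in> {w. mset w = N}"
    then show "w \<in> ?R" using assms by (cases w rule: rev_cases) auto
  qed auto
  then have "(\<Sum>w | mset w = N. g w) =
      (\<Sum>b\<in>set_mset N. sum g ((\<lambda>v. v @ [b]) ` {v. mset v = N - {#b#}}))"
    by (simp only:) (rule sum.UNION_disjoint, auto simp: finite_mset_eq)
  also have "\<dots> = (\<Sum>b\<in>set_mset N. \<Sum>v | mset v = N - {#b#}. g (v @ [b]))"
    by (rule sum.cong[OF refl], subst sum.reindex) (auto simp: inj_on_def)
  finally show ?thesis .
qed

text \<open>The name reads \<open>(x, z) \<in> S\<close> as "x is greater than z", matching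
  \<open>inversions\<close>. When \<open>S\<close> is read as precedence, such a set is an initial
  segment.\<close>

definition upset :: "('a \<times> 'a) set \<Rightarrow> 'a set \<Rightarrow> 'a set \<Rightarrow> bool" where
  "upset S A L \<longleftrightarrow> (\<forall>x\<in>L. \<forall>z\<in>A - L. (x, z) \<in> S)"

definition kappa_extensible :: "('a \<times> 'a) set \<Rightarrow> 'a set \<Rightarrow> ('a \<times> 'a) set \<Rightarrow> bool" where
  "kappa_extensible S A U \<longleftrightarrow> U \<subseteq> S \<and> (\<forall>y. upset S A {x. (x, y) \<in> U})"

text \<open>The extra term makes the induction on the length close up: after removing the last letter \<open>b\<close>
  of a word, the contribution of \<open>b\<close> to \<open>maj'\<close> is the extra term of the prefix for the upset of
  all \<open>x\<close> with \<open>(x, b) \<in> U\<close>.\<close>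

lemma gen_fun_upset:
  fixes q :: "'a :: comm_ring_1"
  assumes S: "strict_linear_order_on A S" and U: "kappa_extensible S A U"
    and "set_mset N \<subseteq> A" and "upset S A L"
  shows "qprod_mset q N *
      (\<Sum>w | mset w = N. q ^ (maj' U w + inv' (S - U) w + (if w \<noteq> [] \<and> last w \<in> L then length w else 0))) =
      qprod q (size N) * q ^ size {#z \<in># N. z \<in> L#}"
  using assms(3,4)
proof (induction "size N" arbitrary: N L)
  case 0
  then show ?case by (simp add: qprod_mset_def)
next
  case (Suc n)
  let ?st = "\<lambda>L w. maj' U w + inv' (S - U) w + (if w \<noteq> [] \<and> last w \<in> L then length w else 0)"
  let ?A = "set_mset N" and ?c = "count N"
  have step: "qprod_mset q N * (\<Sum>v | mset v = N - {#b#}. q ^ ?st L (v @ [b])) =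
      qprod q n * (q ^ (if b \<in> L then sum ?c ?A else 0) * q ^ sum ?c {z \<in> ?A. (z, b) \<in> S} * (1 - q ^ ?c b))"
    if b: "b \<in># N" for b
  proof -
    let ?N = "N - {#b#}" and ?Lb = "{x. (x, b) \<in> U}"
    let ?e = "size {#y \<in># ?N. (y, b) \<in> S - U#}" and ?l = "if b \<in> L then size N else 0"
    have n: "size ?N = n" using Suc.hyps(2) b by (simp add: size_Diff_singleton)
    have st: "?st L (v @ [b]) = ?st ?Lb v + ?e + ?l" if "mset v = ?N" for v
    proof -
      have "Suc (length v) = size N"
        using that b by (metis Suc.hyps(2) n size_mset)
      then show ?thesis
        using that by (simp add: maj'_snoc inv'_snoc)
    qed
    have "(\<Sum>v | mset v = ?N. q ^ ?st L (v @ [b])) = (\<Sum>v | mset v = ?N. q ^ ?st ?Lb v) * q ^ (?e + ?l)"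
      unfolding sum_distrib_right by (intro sum.cong refl) (simp only: mem_Collect_eq st power_add mult.assoc)
    then have "qprod_mset q N * (\<Sum>v | mset v = ?N. q ^ ?st L (v @ [b])) =
        (qprod_mset q ?N * (\<Sum>v | mset v = ?N. q ^ ?st ?Lb v)) * q ^ (?e + ?l) * (1 - q ^ ?c b)"
      by (simp only: qprod_mset_remove[OF b] mult_ac)
    also have "qprod_mset q ?N * (\<Sum>v | mset v = ?N. q ^ ?st ?Lb v) =
        qprod q n * q ^ size {#z \<in># ?N. z \<in> ?Lb#}"
    proof -
      have "set_mset ?N \<subseteq> A" "upset S A ?Lb"
        using Suc.prems(1) U by (auto simp: kappa_extensible_def dest: in_diffD)
      from Suc.hyps(1)[OF n[symmetric] this] show ?thesis by (simp only: n)
    qed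
    also have "size {#z \<in># ?N. z \<in> ?Lb#} = size {#z \<in># ?N. (z, b) \<in> U#}" by simp
    finally have "qprod_mset q N * (\<Sum>v | mset v = ?N. q ^ ?st L (v @ [b])) =
        qprod q n * (q ^ ?l * q ^ (size {#z \<in># ?N. (z, b) \<in> U#} + ?e) * (1 - q ^ ?c b))"
      by (simp only: power_add mult_ac)
    \<comment> \<open>The induction hypothesis contributes the pairs in \<open>U\<close> and
      \<open>inv'\<close> those in \<open>S - U\<close>. Since \<open>U \<subseteq> S\<close>,
      together they count all predecessors of \<open>b\<close>, and \<open>U\<close>
      disappears.\<close>
    also have "size {#z \<in># ?N. (z, b) \<in> U#} + ?e = size {#z \<in># ?N. (z, b) \<in> S#}"
    proof -
      have "{#z \<in># ?N. (z, b) \<in> S#} = {#z \<in># ?N. (z, b) \<in> U#} + {#z \<in># ?N. (z, b) \<in> S - U#}"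
        using U by (intro multiset_eqI) (auto simp: kappa_extensible_def)
      then show ?thesis by simp
    qed
    \<comment> \<open>By irreflexivity \<open>b\<close> itself is not counted, so its removed copy
      can be restored.\<close>
    also have "{#z \<in># ?N. (z, b) \<in> S#} = {#z \<in># N. (z, b) \<in> S#}"
      using S by (simp add: strict_linear_order_on_def irrefl_def)
    finally show ?thesis
      by (simp only: size_filter_mset_conv_sum size_multiset_overloaded_eq[of N])
  qed
  have N: "N \<noteq> {#}" using Suc.hyps(2) by auto
  have up: "(x, z) \<in> S" if "x \<in> L" "z \<in> ?A - L" for x z
    using that Suc.prems by (auto simp: upset_def)
  have "qprod_mset q N * (\<Sum>w | mset w = N. q ^ ?st L w) =
      qprod q n * (\<Sum>b\<in>?A. q ^ (if b \<in> L then sum ?c ?A else 0) *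
        q ^ sum ?c {z \<in> ?A. (z, b) \<in> S} * (1 - q ^ ?c b))"
    unfolding sum_mset_eq_snoc[OF N] sum_distrib_left[where A = "set_mset N"] by (intro sum.cong refl step)
  also have "\<dots> = qprod q n * (q ^ sum ?c (?A \<inter> L) * (1 - q ^ sum ?c ?A))"
    by (simp only: sum_telescope_upset[OF finite_set_mset strict_linear_order_on_subset[OF S Suc.prems(1)] up])
  also have "sum ?c (?A \<inter> L) = size {#z \<in># N. z \<in> L#}"
    by (simp only: size_filter_mset_conv_sum Int_def mem_Collect_eq)
  also have "sum ?c ?A = Suc n"
    using Suc.hyps(2) by (simp add: size_multiset_overloaded_eq)
  also have "qprod q n * (q ^ size {#z \<in># N. z \<in> L#} * (1 - q ^ Suc n)) =
      qprod q (Suc n) * q ^ size {#z \<in># N. z \<in> L#}"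
    by (simp add: qprod_def mult_ac)
  finally show ?case by (simp only: Suc.hyps(2))
qed

text \<open>For the empty upset the extra term vanishes. The right-hand side involves neither
  \<open>S\<close> nor \<open>U\<close>, so all these statistics are equidistributed.\<close>

corollary gen_fun_kappa_extensible:
  fixes q :: "'a :: comm_ring_1"
  assumes "strict_linear_order_on A S" "kappa_extensible S A U" "set_mset N \<subseteq> A"
  shows "qprod_mset q N * (\<Sum>w | mset w = N. q ^ (maj' U w + inv' (S - U) w)) = qprod q (size N)"
  using gen_fun_upset[OF assms, of "{}" q] by (simp add: upset_def)

text \<open>Each factor has constant coefficient 1. This allows cancellation when \<open>q\<close>
  is the polynomial indeterminate.\<close>

lemma qprod_mset_monom_nonzero: "qprod_mset (monom (1 :: 'a :: idom) 1) N \<noteq> 0"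
proof -
  have "(1 :: 'a poly) - monom 1 1 ^ Suc i \<noteq> 0" for i
  proof
    assume "(1 :: 'a poly) - monom 1 1 ^ Suc i = 0"
    then have "coeff ((1 :: 'a poly) - monom 1 (Suc i)) 0 = 0"
      by (simp add: monom_power del: power_Suc)
    then show False by simp
  qed
  then show ?thesis by (simp add: qprod_mset_def qprod_def del: power_Suc)
qed

section \<open>Mahonian statistics and their generating functions\<close>

lemma inversions_conv_inv': "inversions w = inv' {(x, y). y < x} w"
  by (simp add: inversions_def inv'_def)

lemma rearrangements_conv:
  obtains N where "rearrangements r c = {w. mset w = N}" "set_mset N \<subseteq> alphabet r"
  by (rule that[of "mset (concat (map (\<lambda>x. replicate (c x) x) [1..<Suc r]))"])
    (auto simp: rearrangements_def alphabet_def)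

text \<open>Makes the mahonian property applicable to the class of a concrete word, with its letter
  counts as multiplicities.\<close>

lemma rearrangements_count:
  assumes "w \<in> words r"
  shows "rearrangements r (count (mset w)) = {v. mset v = mset w}"
proof -
  have "count (mset (concat (map (\<lambda>x. replicate (c x) x) xs))) y = (if y \<in> set xs then c y else 0)"
    if "distinct xs" for c xs and y :: nat
    using that by (induction xs) auto
  then have "mset (concat (map (\<lambda>x. replicate (count (mset w) x) x) [1..<Suc r])) = mset w"
    using assms by (intro multiset_eqI) (auto simp: words_def alphabet_def not_in_iff[symmetric] simp del: upt_Suc)
  then show ?thesis by (simp add: rearrangements_def)
qed

lemma kappa_extensible_imp_mahonian:
  assumes "strict_linear_order_on (alphabet r) S" "kappa_extensible S (alphabet r) U"
  shows "mahonian r (maj_inv r U (S - U))"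
  unfolding mahonian_def
proof
  fix c
  obtain N where R: "rearrangements r c = {w. mset w = N}" and N: "set_mset N \<subseteq> alphabet r"
    by (rule rearrangements_conv)
  let ?q = "monom (1 :: int) 1"
  have "w \<in> words r" if "mset w = N" for w
    using that N by (auto simp: words_def)
  then have "qprod_mset ?q N * (\<Sum>w | mset w = N. monom 1 (maj_inv r U (S - U) w)) =
      qprod_mset ?q N * (\<Sum>w | mset w = N. ?q ^ (maj' U w + inv' (S - U) w))"
    by (simp add: maj_inv_def monom_power)
  also have "\<dots> = qprod ?q (size N)"
    by (rule gen_fun_kappa_extensible[OF assms N])
  \<comment> \<open>\<open>inversions\<close> is itself an instance: the order is \<open>>\<close>
    on \<open>UNIV\<close> and the relation is empty.\<close>
  also have "\<dots> = qprod_mset ?q N *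
      (\<Sum>w | mset w = N. ?q ^ (maj' {} w + inv' ({(x, y). y < x} - {}) w))"
    by (rule gen_fun_kappa_extensible[symmetric, of UNIV])
      (auto simp: strict_linear_order_on_def trans_def irrefl_def total_on_def kappa_extensible_def upset_def)
  also have "\<dots> = qprod_mset ?q N * (\<Sum>w | mset w = N. monom 1 (inversions w))"
    by (simp add: maj'_def monom_power inversions_conv_inv')
  finally show "(\<Sum>w\<in>rearrangements r c. monom (1 :: int) (maj_inv r U (S - U) w)) =
      (\<Sum>w\<in>rearrangements r c. monom 1 (inversions w))"
    using qprod_mset_monom_nonzero[where 'a = int, of N] unfolding R mult_cancel_left by blast
qed

text \<open>The coefficient of degree \<open>k\<close> counts the words with value \<open>k\<close>,
  so a value attained by \<open>f\<close> is attained by \<open>g\<close>.\<close>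

lemma sum_monom_eq_imp_image_subset:
  fixes f g :: "'b \<Rightarrow> nat"
  assumes "finite A" "(\<Sum>w\<in>A. monom (1 :: int) (f w)) = (\<Sum>w\<in>A. monom 1 (g w))"
  shows "f ` A \<subseteq> g ` A"
proof
  fix k assume "k \<in> f ` A"
  then have "card {w \<in> A. f w = k} \<noteq> 0" using assms(1) by (auto simp: card_eq_0_iff)
  have *: "coeff (\<Sum>w\<in>A. monom (1 :: int) (h w)) k = int (card {w \<in> A. h w = k})" for h :: "'b \<Rightarrow> nat"
    using assms(1) by (simp add: coeff_sum sum.If_cases Int_def)
  have "card {w \<in> A. f w = k} = card {w \<in> A. g w = k}"
    using arg_cong[OF assms(2), of "\<lambda>p. coeff p k"] unfolding * by simp
  then have "{w \<in> A. g w = k} \<noteq> {}"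
    using \<open>card {w \<in> A. f w = k} \<noteq> 0\<close> by (intro notI) (simp only: card.empty)
  then show "k \<in> g ` A" by auto
qed

lemma mahonian_image_eq:
  assumes "mahonian r s" "w \<in> words r"
  shows "s ` {v. mset v = mset w} = inversions ` {v. mset v = mset w}"
proof -
  have "(\<Sum>v | mset v = mset w. monom (1 :: int) (s v)) = (\<Sum>v | mset v = mset w. monom 1 (inversions v))"
    using assms(1) unfolding mahonian_def rearrangements_count[OF assms(2), symmetric] by (rule spec)
  then show ?thesis
    by (intro equalityI sum_monom_eq_imp_image_subset finite_mset_eq) simp_all
qed

section \<open>Necessity from words of two and three letters\<close>

lemma statistic_pair: "maj' U [x, y] + inv' V [x, y] = of_bool ((x, y) \<in> U) + of_bool ((x, y) \<in> V)"
  using maj'_snoc[of U "[x]" y] inv'_snoc[of V "[x]" y] by (simp add: maj'_def inv'_def)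

lemma statistic_triple:
  "maj' U [x, y, z] + inv' V [x, y, z] =
    of_bool ((x, y) \<in> U) + 2 * of_bool ((y, z) \<in> U) +
    of_bool ((x, y) \<in> V) + of_bool ((x, z) \<in> V) + of_bool ((y, z) \<in> V)"
  using maj'_snoc[of U "[x, y]" z] inv'_snoc[of V "[x, y]" z] statistic_pair[of U x y V] by simp

lemma inversions_length_3:
  assumes "length w = 3"
  shows "inversions w \<le> 3"
proof -
  obtain x y z where "w = [x, y, z]"
    using assms by (auto simp: numeral_3_eq_3 length_Suc_conv)
  then have "inversions w = of_bool (y < x) + of_bool (z < x) + of_bool (z < y)"
    using statistic_triple[of "{}" x y z "{(x, y). y < x}"] by (simp add: inversions_conv_inv' maj'_def)
  then show ?thesis by simp
qed

lemma mahonian_imp_kappa_extensible: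
  assumes S: "strict_linear_order_on (alphabet r) S"
    and U: "U \<subseteq> alphabet r \<times> alphabet r" and mah: "mahonian r (maj_inv r U (S - U))"
  shows "kappa_extensible S (alphabet r) U"
proof -
  note asym = strict_linear_order_on_asym[OF S]
  have total: "x = y \<or> (x, y) \<in> S \<or> (y, x) \<in> S" if "x \<in> alphabet r" "y \<in> alphabet r" for x y
    using S that by (auto simp: strict_linear_order_on_def total_on_def)
  have stat: "maj_inv r U (S - U) w = maj' U w + inv' (S - U) w" if "set w \<subseteq> alphabet r" for w
    using that by (auto simp: maj_inv_def words_def)
  note image_eq = mahonian_image_eq[OF mah]
  have US: "(x, y) \<in> S" if xy: "(x, y) \<in> U" for x y
  proof (rule ccontr)
    assume nS: "(x, y) \<notin> S"
    have w: "[x, y] \<in> words r" using xy U by (auto simp: words_def)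
    have perms: "{v. mset v = mset [x, y]} = {[x, y], [y, x]}"
    proof (intro equalityI subsetI)
      fix v assume "v \<in> {v. mset v = mset [x, y]}"
      then have v: "mset v = {#x, y#}" by simp
      then have "length v = 2" by (metis size_mset size_add_mset size_empty numeral_2_eq_2)
      then obtain a b where "v = [a, b]" by (auto simp: numeral_2_eq_2 length_Suc_conv)
      then show "v \<in> {[x, y], [y, x]}" using v by (auto simp: add_eq_conv_ex)
    qed auto
    \<comment> \<open>One of the two words is weakly increasing.\<close>
    have "0 \<in> inversions ` {[x, y], [y, x]}"
      by (auto simp: inversions_def)
    then have "0 \<in> maj_inv r U (S - U) ` {[x, y], [y, x]}"
      using image_eq[OF w] perms by simp
    \<comment> \<open>\<open>[x, y]\<close> has positive value because
      \<open>(x, y) \<in> U\<close>, so the value 0 must come from \<open>[y, x]\<close>.\<close>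
    then have "(y, x) \<notin> U \<and> (y, x) \<notin> S"
      using xy U stat by (auto simp: statistic_pair)
    then show False using total[of x y] nS xy U by auto
  qed
  have "(x, z) \<in> S" if xy: "(x, y) \<in> U" and z: "z \<in> alphabet r" "(z, y) \<notin> U" for x y z
  proof (rule ccontr)
    assume "(x, z) \<notin> S"
    then have zx: "(z, x) \<in> S" using total[of x z] xy z U by auto
    then have zy: "(z, y) \<in> S" using US[OF xy] S by (meson strict_linear_order_on_def transD)
    have w: "[z, x, y] \<in> words r" using xy z U by (auto simp: words_def)
    \<comment> \<open>The pair \<open>(z, x)\<close> gives 1 whether or not it lies in
      \<open>U\<close>, \<open>(x, y)\<close> gives 2 through \<open>maj'\<close>, and
      \<open>(z, y)\<close> gives 1 through \<open>inv'\<close>.\<close>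
    have "maj_inv r U (S - U) [z, x, y] = 4"
      using w xy zx zy z(2) by (auto simp: maj_inv_def statistic_triple)
    then have "4 \<in> inversions ` {v. mset v = mset [z, x, y]}"
      unfolding image_eq[OF w, symmetric] by (intro image_eqI) auto
    then obtain v where "mset v = mset [z, x, y]" "inversions v = 4" by auto
    moreover from this have "length v = 3" by (metis size_mset length_Cons list.size(3) numeral_3_eq_3)
    ultimately show False using inversions_length_3[of v] by simp
  qed
  then show ?thesis using US by (auto simp: kappa_extensible_def upset_def)
qed

section \<open>Counting the admissible relations\<close>

lemma inj_on_maj_inv:
  assumes "strict_linear_order_on (alphabet r) S" "S \<subseteq> alphabet r \<times> alphabet r"
  shows "inj_on (\<lambda>U. maj_inv r U (S - U)) (Collect (kappa_extensible S (alphabet r)))"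
proof (rule inj_onI, unfold mem_Collect_eq)
  fix U U' assume *: "kappa_extensible S (alphabet r) U" "kappa_extensible S (alphabet r) U'"
    and eq: "maj_inv r U (S - U) = maj_inv r U' (S - U')"
  have "(x, y) \<in> U \<longleftrightarrow> (x, y) \<in> U'" if xy: "(x, y) \<in> S" for x y
  proof -
    have w: "[y, x, y] \<in> words r" using xy assms(2) by (auto simp: words_def)
    \<comment> \<open>On \<open>[x, y]\<close> both alternatives give 1. The leading
      \<open>y\<close> moves the pair to position 2, where it counts 2 if it lies in
      \<open>V\<close> and 1 otherwise; the pairs \<open>(y, x)\<close> and \<open>(y, y)\<close>
      contribute nothing.\<close>
    have val: "maj_inv r V (S - V) [y, x, y] = 1 + of_bool ((x, y) \<in> V)"
      if "kappa_extensible S (alphabet r) V" for V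
    proof -
      have "(y, x) \<notin> S" "(y, y) \<notin> S"
        using xy strict_linear_order_on_asym[OF assms(1)] by blast+
      then show ?thesis
        using w xy that by (auto simp: maj_inv_def statistic_triple kappa_extensible_def)
    qed
    from eq have "maj_inv r U (S - U) [y, x, y] = maj_inv r U' (S - U') [y, x, y]" by simp
    then show ?thesis by (simp add: val[OF *(1)] val[OF *(2)] of_bool_def split: if_splits)
  qed
  then show "U = U'" using * unfolding kappa_extensible_def by auto
qed

lemma card_kappa_extensible:
  assumes "finite A" and S: "strict_linear_order_on A S" and "S \<subseteq> A \<times> A"
  shows "card (Collect (kappa_extensible S A)) = fact (card A)"
proof -
  let ?F = "PiE A (\<lambda>y. {t \<in> A. t = y \<or> (t, y) \<in> S})"
  \<comment> \<open>\<open>k y\<close> is a threshold: the column at \<open>y\<close> consists of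
    its predecessors. As \<open>k y\<close> is \<open>y\<close> or precedes it, the resulting
    relation lies in \<open>S\<close>.\<close>
  let ?rel = "\<lambda>k. {(z, y). y \<in> A \<and> (z, k y) \<in> S}"
  note asym = strict_linear_order_on_asym[OF S]
  have tr: "trans S" and total: "\<And>x y. x \<in> A \<Longrightarrow> y \<in> A \<Longrightarrow> x = y \<or> (x, y) \<in> S \<or> (y, x) \<in> S"
    using S by (auto simp: strict_linear_order_on_def total_on_def)
  have "bij_betw ?rel ?F (Collect (kappa_extensible S A))"
    unfolding bij_betw_def
  proof
    show "inj_on ?rel ?F"
    proof (rule inj_onI)
      fix k l assume kl: "k \<in> ?F" "l \<in> ?F" and eq: "?rel k = ?rel l"
      show "k = l"
      proof (rule PiE_ext[OF kl])
        fix y assume y: "y \<in> A"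
        then have "(z, k y) \<in> S \<longleftrightarrow> (z, l y) \<in> S" for z using eq by blast
        \<comment> \<open>If two thresholds differed, the earlier one would precede the later but
          not itself.\<close>
        then show "k y = l y" using total[of "k y" "l y"] asym kl y by blast
      qed
    qed
    \<comment> \<open>An upset missing \<open>y\<close> is the set of predecessors of the first element outside it.\<close>
    show "?rel ` ?F = Collect (kappa_extensible S A)"
    proof (intro equalityI subsetI)
      fix U assume "U \<in> ?rel ` ?F"
      then obtain k where k: "k \<in> ?F" and U: "U = ?rel k" by auto
      have "U \<subseteq> S" using k U tr by (fastforce dest: transD PiE_mem)
      moreover have "(x, z) \<in> S" if "(x, y) \<in> U" "z \<in> A" "(z, y) \<notin> U" for x y z
      proof -
        have "y \<in> A" "(x, k y) \<in> S" "(z, k y) \<notin> S" "k y \<in> A" using that U k by auto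
        then show ?thesis using total[of z "k y"] that(2) tr by (auto dest: transD)
      qed
      ultimately show "U \<in> Collect (kappa_extensible S A)"
        by (auto simp: kappa_extensible_def upset_def)
    next
      fix U assume "U \<in> Collect (kappa_extensible S A)"
      then have US: "U \<subseteq> S" and up: "\<And>x y z. (x, y) \<in> U \<Longrightarrow> z \<in> A \<Longrightarrow> (z, y) \<notin> U \<Longrightarrow> (x, z) \<in> S"
        by (auto simp: kappa_extensible_def upset_def)
      have "\<exists>t. t \<in> A \<and> (t = y \<or> (t, y) \<in> S) \<and> (\<forall>z. (z, t) \<in> S \<longleftrightarrow> (z, y) \<in> U)" if y: "y \<in> A" for y
      proof -
        \<comment> \<open>Only elements up to \<open>y\<close> are considered, so that the threshold
          lies in the initial segment of \<open>y\<close>. The set is nonempty because irreflexivity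
          keeps \<open>y\<close> out of its own column.\<close>
        let ?B = "{t \<in> A. (t = y \<or> (t, y) \<in> S) \<and> (t, y) \<notin> U}"
        have "y \<in> ?B" using y US asym by blast
        moreover have "strict_linear_order_on ?B S"
          by (rule strict_linear_order_on_subset[OF S]) auto
        ultimately obtain t where t: "t \<in> ?B" "\<And>z. z \<in> ?B \<Longrightarrow> z \<noteq> t \<Longrightarrow> (t, z) \<in> S"
          using strict_linear_order_on_first[of ?B S thesis] assms(1) by auto
        have "(z, y) \<in> U" if "(z, t) \<in> S" for z
        proof (rule ccontr)
          assume "(z, y) \<notin> U"
          then have "z \<in> ?B" using that t(1) tr assms(3) by (auto dest: transD)
          then show False using t(2)[of z] that asym by blast
        qed
        then show ?thesis using t(1) up by blast
      qed
      then obtain k where k: "\<And>y. y \<in> A \<Longrightarrow> k y \<in> A \<and> (k y = y \<or> (k y, y) \<in> S) \<and> (\<forall>z. (z, k y) \<in> S \<longleftrightarrow> (z, y) \<in> U)"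
        by metis
      show "U \<in> ?rel ` ?F"
      proof (rule image_eqI)
        show "restrict k A \<in> ?F" using k by auto
        show "U = ?rel (restrict k A)" using k US assms(3) by (auto cong: conj_cong)
      qed
    qed
  qed
  then have "card (Collect (kappa_extensible S A)) = card ?F"
    by (simp add: bij_betw_same_card)
  also have "\<dots> = fact (card A)"
    using prod_card_initial_segments[OF assms(1) S] by (simp add: card_PiE assms(1))
  finally show ?thesis .
qed

theorem corollary1p11:
  fixes r :: nat and S :: "(nat \<times> nat) set"
  assumes "r \<ge> 1"
    and "S \<subseteq> alphabet r \<times> alphabet r"
    and "strict_linear_order_on (alphabet r) S"
  shows "card {s. maj_inv_statistic r s \<and> mahonian r s \<and>
                  (\<exists>U. U \<subseteq> alphabet r \<times> alphabet r \<and> s = maj_inv r U (S - U))} =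
         fact (card (alphabet r))"
proof -
  let ?A = "alphabet r"
  \<comment> \<open>The set to be counted is the injective image of the admissible
    relations.\<close>
  have "{s. maj_inv_statistic r s \<and> mahonian r s \<and>
            (\<exists>U. U \<subseteq> ?A \<times> ?A \<and> s = maj_inv r U (S - U))} =
        (\<lambda>U. maj_inv r U (S - U)) ` Collect (kappa_extensible S ?A)"
  proof (intro equalityI subsetI)
    fix s assume "s \<in> (\<lambda>U. maj_inv r U (S - U)) ` Collect (kappa_extensible S ?A)"
    then obtain U where U: "kappa_extensible S ?A U" and s: "s = maj_inv r U (S - U)" by auto
    have "U \<subseteq> ?A \<times> ?A" "S - U \<subseteq> ?A \<times> ?A"
      using U assms(2) by (auto simp: kappa_extensible_def)
    then show "s \<in> {s. maj_inv_statistic r s \<and> mahonian r s \<and>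
        (\<exists>U. U \<subseteq> ?A \<times> ?A \<and> s = maj_inv r U (S - U))}"
      using s kappa_extensible_imp_mahonian[OF assms(3) U] unfolding maj_inv_statistic_def by blast
  qed (use mahonian_imp_kappa_extensible[OF assms(3)] in blast)
  then show ?thesis
    using card_image[OF inj_on_maj_inv[OF assms(3,2)]] card_kappa_extensible[OF _ assms(3,2)]
    by (simp add: alphabet_def)
qed

end
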